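(* Let $q,p$ be prime numbers such that $p$ is congruent modulo $q$ to a primitive root modulo $q$. Let $s$ be an integer with $1\le s\le q-1$ and let $r\ge 1$ be an integer. Then $$\sharp\,\mathrm{GL}^{s}_{q\times r}(\mathbb F_p)\;\ge\;\prod_{0\le i\le r-1}\left(\frac1q\binom{q}{s}\left((p-1)^s-(p-1)^{s-1}\right)(q-i)\right).$$
   Context: $\mathrm{GL}^{s}_{n\times r}(\mathbb F_p)$ denotes the set of full-rank $n\times r$ matrices over the finite field $\mathbb F_p$ having exactly $s$ non-zero entries in each column, and $\sharp$ denotes cardinality. *)

theory Defs
  imports
    "Jordan_Normal_Form.DL_Rank"
    "Berlekamp_Zassenhaus.Finite_Field"
    "HOL-Number_Theory.Residue_Primitive_Roots"
begin

definition GL_fixed_col_weight :: "nat \<Rightarrow> nat \<Rightarrow> nat \<Rightarrow> 'a :: field mat set" where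
  "GL_fixed_col_weight s n r =
     {A \<in> carrier_mat n r.
        vec_space.rank n A = min n r \<and>
        (\<forall>j<r. card {i. i < n \<and> A $$ (i, j) \<noteq> 0} = s)}"

end

theory Submission
  imports Defs "Berlekamp_Zassenhaus.Distinct_Degree_Factorization"
begin

text \<open>
  Let \<open>W\<close> be the set of vectors of weight \<open>s\<close> with nonzero coordinate sum. Identify a vector with a
  polynomial modulo \<open>x^q - 1 = (x - 1) \<Phi>\<close>, where \<open>\<Phi> = 1 + x + \<dots> + x^(q-1)\<close>, so that a cyclic
  rotation is multiplication by \<open>x\<close>. As \<open>p\<close> generates the units modulo \<open>q\<close>, the polynomial \<open>\<Phi>\<close> is
  irreducible over the field with \<open>p\<close> elements. A vector in \<open>W\<close> is divisible neither by \<open>x - 1\<close> (its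
  sum is nonzero) nor by \<open>\<Phi>\<close> (\<open>s < q\<close>), hence is a unit and its \<open>q\<close> rotations are linearly
  independent. A subspace \<open>U\<close> of dimension \<open>i\<close> thus contains at most \<open>i\<close> of them; counting pairs
  (vector in \<open>W\<close>, rotation taking it into \<open>U\<close>) in two ways gives \<open>q |W \<inter> U| \<le> i |W|\<close>, so given
  \<open>i\<close> independent columns from \<open>W\<close> there are at least \<open>|W| (q - i) / q\<close> choices for the next one.
  Finally \<open>|W| \<ge> (q choose s) ((p-1)^s - (p-1)^(s-1))\<close>, because a nowhere-zero zero-sum function on an
  \<open>s\<close>-set is determined by all but one of its values.
\<close>


hide_const (open) up_ring.monom up_ring.coeff Divisibility.irreducible comm_monoid_mult_class.coprime

section \<open>Irreducibility of 1 + X + ... + X^(q-1) over the field with p elements\<close>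

definition geom_poly :: "nat \<Rightarrow> 'a :: field poly" where
  "geom_poly n = (\<Sum>i<n. monom 1 i)"

lemma coeff_geom_poly: "coeff (geom_poly n) i = (if i < n then 1 else 0)"
  by (simp add: geom_poly_def coeff_sum sum.delta')

lemma geom_poly_neq_0: "n > 0 \<Longrightarrow> geom_poly n \<noteq> 0"
  by (auto dest!: arg_cong[where f = "\<lambda>p. coeff p 0"] simp: coeff_geom_poly)

lemma degree_geom_poly: "degree (geom_poly n :: 'a :: field poly) = n - 1"
proof (cases "n = 0")
  case False
  then show ?thesis
    by (intro antisym degree_le le_degree) (auto simp: coeff_geom_poly)
qed (simp add: geom_poly_def)

lemma poly_geom_poly_1: "poly (geom_poly n) 1 = of_nat n"
  by (simp add: geom_poly_def poly_sum poly_monom)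

lemma monom_minus_1_eq_geom_poly: "monom 1 n - 1 = (monom 1 1 - 1) * geom_poly n"
proof -
  have "monom 1 n - 1 = (monom 1 1 :: 'a poly) ^ n - 1"
    by (simp add: monom_power)
  also have "\<dots> = (monom 1 1 - 1) * (\<Sum>i<n. monom 1 1 ^ i)"
    by (rule power_diff_1_eq)
  also have "(\<Sum>i<n. (monom 1 1 :: 'a poly) ^ i) = geom_poly n"
    by (simp add: geom_poly_def monom_power)
  finally show ?thesis .
qed

lemma monom_1_minus_1: "monom 1 1 - 1 = [:-1, 1 :: 'a :: field:]"
  by (rule poly_eqI) (auto simp: coeff_pCons split: nat.splits)

lemma of_nat_mod_ring_neq_0:
  assumes "coprime n CARD('a :: prime_card)"
  shows "(of_nat n :: 'a mod_ring) \<noteq> 0"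
proof
  assume "(of_nat n :: 'a mod_ring) = 0"
  then have "CARD('a) dvd n"
    by (metis of_nat_0_mod_ring_dvd)
  moreover have "prime CARD('a)" by (rule prime_card)
  ultimately show False
    using assms coprime_common_divisor[of n "CARD('a)" "CARD('a)"] by auto
qed

text \<open>Let f be an irreducible factor, of degree d. Modulo f, both X^q and X^(p^d - 1) are 1.
  If q did not divide p^d - 1, the two exponents would be coprime and X would be 1 modulo f, making
  1 a root of \<open>geom_poly q\<close>; but the value there is q, which is nonzero in the field.
  Hence the order q - 1 of p modulo q divides d, and f already has the full degree.\<close>

lemma irreducible_geom_poly:
  assumes q: "prime q" and prim: "residue_primroot q CARD('a :: prime_card)"
  shows "irreducible (geom_poly q :: 'a mod_ring poly)"
proof -
  let ?p = "CARD('a)" and ?X = "monom 1 1 :: 'a mod_ring poly"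
  let ?G = "geom_poly q :: 'a mod_ring poly"
  have q0: "q > 1" using q prime_gt_1_nat by blast
  have "?G \<noteq> 0" using q0 by (simp add: geom_poly_neq_0)
  moreover have "\<not> ?G dvd 1" using q0 by (simp add: degree_geom_poly is_unit_iff_degree[OF \<open>?G \<noteq> 0\<close>])
  ultimately obtain f where f: "f dvd ?G" "prime_elem f"
    using prime_divisor_exists by blast
  then have irr: "irreducible f" by (simp add: prime_elem_imp_irreducible)
  have deg_f: "degree f > 0" "f \<noteq> 0"
    using irr by (auto simp: irreducible_def is_unit_iff_degree)
  define d where "d = degree f"
  have X0: "[?X ^ q = 1] (mod f)"
    using f(1) monom_minus_1_eq_geom_poly[of q, where 'a = "'a mod_ring"]
    by (metis cong_iff_dvd_diff dvd_mult monom_power mult_1 power_one)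
  have fX: "f dvd ?X ^ (?p ^ d) - ?X"
    using degree_divisor1[OF irr] by (simp add: d_def)
  have pd: "?p ^ d > 0" by simp
  \<comment> \<open>Since X^q is 1 modulo f, X is a unit there and one factor X can be cancelled
    from \<open>fX\<close>.\<close>
  have "coprime f (?X ^ q)"
    using cong_imp_coprime[OF cong_sym[OF X0]] by (simp add: algebraic_semidom_class.coprime_commute)
  then have "coprime f ?X" using q0 by simp
  moreover have "?X ^ (?p ^ d) - ?X = ?X * (?X ^ (?p ^ d - 1) - 1)"
    using pd by (cases "?p ^ d") (simp_all add: algebra_simps)
  ultimately have "f dvd ?X ^ (?p ^ d - 1) - 1"
    using fX by (simp add: coprime_dvd_mult_right_iff)
  then have Xn: "[?X ^ (?p ^ d - 1) = 1] (mod f)"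
    by (simp add: cong_iff_dvd_diff)
  have "q dvd ?p ^ d - 1"
  proof (rule ccontr)
    assume "\<not> q dvd ?p ^ d - 1"
    then have "coprime (?p ^ d - 1) q"
      using q by (simp add: algebraic_semidom_class.coprime_commute prime_imp_coprime)
    \<comment> \<open>With b inverse to p^d - 1 modulo q, the power X^((p^d - 1) b) is 1 modulo f by
      \<open>Xn\<close> and is X modulo f by \<open>X0\<close>.\<close>
    then obtain b where "[(?p ^ d - 1) * b = 1] (mod q)"
      using cong_solve_coprime_nat by auto
    then have "\<exists>c. (?p ^ d - 1) * b = q * c + 1"
      using q0 by (metis cong_def mod_less mult_div_mod_eq)
    then obtain c where c: "(?p ^ d - 1) * b = q * c + 1" by blast
    have "[(?X ^ (?p ^ d - 1)) ^ b = 1 ^ b] (mod f)" by (rule cong_pow[OF Xn])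
    then have "[(?X ^ q) ^ c * ?X = 1] (mod f)"
      by (simp only: power_mult[symmetric] c power_add power_one power_one_right)
    moreover have "[(?X ^ q) ^ c * ?X = 1 ^ c * ?X] (mod f)"
      by (intro cong_mult cong_pow X0 cong_refl)
    ultimately have "[1 ^ c * ?X = 1] (mod f)"
      using cong_sym cong_trans by blast
    then have "f dvd [:-1, 1:]"
      using monom_1_minus_1[where 'a = "'a mod_ring"] by (simp add: cong_iff_dvd_diff)
    \<comment> \<open>Having positive degree, f is a nonzero scalar multiple of X - 1, so 1 is a
      root of f and of its multiple \<open>geom_poly q\<close>.\<close>
    then obtain g where g: "[:-1, 1:] = f * g" by (elim dvdE)
    then have "f \<noteq> 0" "g \<noteq> 0" by auto
    then have "degree g = 0"
      using arg_cong[OF g, of degree] deg_f by (simp add: degree_mult_eq)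
    then obtain c where "g = [:c:]" by (meson degree_eq_zeroE)
    then have "poly f 1 * c = 0" "c \<noteq> 0"
      using arg_cong[OF g, of "\<lambda>h. poly h 1"] g by auto
    then have "poly ?G 1 = 0" using f(1) by (auto elim!: dvdE)
    then show False
      using prim of_nat_mod_ring_neq_0[of q, where 'a = 'a]
      by (simp add: poly_geom_poly_1 residue_primroot_def)
  qed
  then have "[?p ^ d = 1] (mod q)"
    using pd by (subst cong_altdef_nat) auto
  then have "ord q ?p dvd d" using Pocklington.ord_divides by blast
  then have "q - 1 dvd d"
    using prim q by (simp add: residue_primroot_def totient_prime)
  then have ge: "q - 1 \<le> degree f"
    using deg_f by (simp add: d_def dvd_imp_le)
  obtain g where g: "?G = f * g" using f(1) by (elim dvdE)
  then have "g \<noteq> 0" using \<open>?G \<noteq> 0\<close> by auto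
  then have "degree g = 0"
    using arg_cong[OF g, of degree] ge deg_f by (simp add: degree_geom_poly degree_mult_eq)
  then have "g dvd 1" using \<open>g \<noteq> 0\<close> by (simp add: is_unit_iff_degree)
  then show ?thesis using irr g by (simp add: irreducible_mult_unit_right)
qed

section \<open>Vectors as polynomials modulo X^n - 1, and independence of rotations\<close>

definition vec_poly :: "'a :: field vec \<Rightarrow> 'a poly" where
  "vec_poly v = (\<Sum>i<dim_vec v. monom (v $ i) i)"

definition rotate_vec :: "'a vec \<Rightarrow> 'a vec" where
  "rotate_vec v = vec (dim_vec v) (\<lambda>i. v $ (if i = 0 then dim_vec v - 1 else i - 1))"

lemma coeff_vec_poly: "coeff (vec_poly v) i = (if i < dim_vec v then v $ i else 0)"
  by (simp add: vec_poly_def coeff_sum sum.delta')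

lemma rotate_vec_carrier [simp]: "v \<in> carrier_vec n \<Longrightarrow> rotate_vec v \<in> carrier_vec n"
  by (simp add: rotate_vec_def)

lemma funpow_rotate_vec_carrier [simp]:
  "v \<in> carrier_vec n \<Longrightarrow> (rotate_vec ^^ k) v \<in> carrier_vec n"
  by (induction k) auto

text \<open>Multiplication by X moves every coefficient up by one; the last entry lands at X^n, and
  the multiple of X^n - 1 accounts for carrying it back to position 0.\<close>

lemma vec_poly_rotate_vec:
  assumes "v \<in> carrier_vec n" "n > 0"
  shows "monom 1 1 * vec_poly v = vec_poly (rotate_vec v) + smult (v $ (n - 1)) (monom 1 n - 1)"
proof (rule poly_eqI)
  fix i
  obtain m where "n = Suc m" using assms(2) gr0_implies_Suc by blast
  then show "coeff (monom 1 1 * vec_poly v) i =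
      coeff (vec_poly (rotate_vec v) + smult (v $ (n - 1)) (monom 1 n - 1)) i"
    using assms by (cases i) (auto simp: coeff_monom_mult coeff_vec_poly rotate_vec_def less_Suc_eq)
qed

lemma vec_poly_funpow_rotate_vec:
  assumes "v \<in> carrier_vec n" "n > 0"
  shows "[monom 1 k * vec_poly v = vec_poly ((rotate_vec ^^ k) v)] (mod (monom 1 n - 1))"
proof (induction k)
  case (Suc k)
  let ?w = "(rotate_vec ^^ k) v"
  have "[monom 1 1 * (monom 1 k * vec_poly v) = monom 1 1 * vec_poly ?w] (mod (monom 1 n - 1))"
    by (intro cong_mult cong_refl Suc)
  moreover have "[monom 1 1 * vec_poly ?w = vec_poly (rotate_vec ?w)] (mod (monom 1 n - 1))"
    unfolding cong_iff_dvd_diff using vec_poly_rotate_vec[of ?w n] assms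
    by (simp add: dvd_smult)
  ultimately show ?case
    by (auto simp: mult.assoc[symmetric] mult_monom intro: cong_trans)
qed simp

text \<open>A multiple of \<open>geom_poly n\<close> of degree below n is a constant multiple, so
  all entries of v would be equal. Their sum is nonzero, so they would all be nonzero, against the
  hypothesis on the support.\<close>

lemma geom_poly_not_dvd_vec_poly:
  assumes v: "v \<in> carrier_vec n" and supp: "card {i. i < n \<and> v $ i \<noteq> 0} \<noteq> n"
    and v0: "(\<Sum>i<n. v $ i) \<noteq> 0"
  shows "\<not> geom_poly n dvd vec_poly v"
proof
  assume "geom_poly n dvd vec_poly v"
  then obtain g where g: "vec_poly v = geom_poly n * g" by (elim dvdE)
  have n: "n > 0" using v0 by (cases n) auto
  have "poly (vec_poly v) 1 = (\<Sum>i<n. v $ i)"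
    using v by (simp add: vec_poly_def poly_sum poly_monom)
  then have "g \<noteq> 0" using v0 g by auto
  have "degree (vec_poly v) \<le> n - 1"
    using v n by (intro degree_le) (auto simp: coeff_vec_poly)
  then have "degree g = 0"
    using g \<open>g \<noteq> 0\<close> geom_poly_neq_0[OF n, where 'a = 'a]
    by (simp add: degree_mult_eq degree_geom_poly)
  then obtain c where c: "g = [:c:]" by (meson degree_eq_zeroE)
  have "v $ i = c" if "i < n" for i
    using arg_cong[OF g, of "\<lambda>h. coeff h i"] that v
    by (simp add: c coeff_vec_poly coeff_geom_poly)
  moreover have "c \<noteq> 0" using \<open>g \<noteq> 0\<close> c by auto
  ultimately have "{i. i < n \<and> v $ i \<noteq> 0} = {..<n}" by auto
  then show False using supp by simp
qed

text \<open>A vanishing combination of the rotations says that B times \<open>vec_poly v\<close> is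
  0 modulo X^n - 1, where B has the coefficients b. Neither \<open>geom_poly n\<close> nor X - 1
  divides \<open>vec_poly v\<close>, and both are prime, so B is a multiple of
  \<open>geom_poly n\<close> that vanishes at 1. As B has degree below n, it is c times
  \<open>geom_poly n\<close> with n c = 0, hence B = 0.\<close>

lemma rotations_independent:
  fixes v :: "'a :: field vec"
  assumes irr: "irreducible (geom_poly n :: 'a poly)" and n0: "(of_nat n :: 'a) \<noteq> 0"
    and v: "v \<in> carrier_vec n" and supp: "card {i. i < n \<and> v $ i \<noteq> 0} \<noteq> n"
    and v0: "(\<Sum>i<n. v $ i) \<noteq> 0"
    and b: "\<And>i. i < n \<Longrightarrow> (\<Sum>k<n. b k * (rotate_vec ^^ k) v $ i) = 0" and k: "k < n"
  shows "b k = 0"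
proof -
  have n: "n > 0" using k by simp
  let ?G = "geom_poly n :: 'a poly" and ?N = "monom 1 n - 1 :: 'a poly"
  define B where "B = (\<Sum>k<n. monom (b k) k)"
  have "B * vec_poly v = (\<Sum>k<n. smult (b k) (monom 1 k * vec_poly v))"
    by (simp add: B_def sum_distrib_right smult_monom_mult)
  moreover have "[(\<Sum>k<n. smult (b k) (monom 1 k * vec_poly v)) =
      (\<Sum>k<n. smult (b k) (vec_poly ((rotate_vec ^^ k) v)))] (mod ?N)"
  proof (intro cong_sum)
    fix k
    show "[smult (b k) (monom 1 k * vec_poly v)
        = smult (b k) (vec_poly ((rotate_vec ^^ k) v))] (mod ?N)"
      using vec_poly_funpow_rotate_vec[OF v n, of k]
      by (simp add: cong_iff_dvd_diff smult_diff_right[symmetric] dvd_smult)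
  qed
  moreover have "(\<Sum>k<n. smult (b k) (vec_poly ((rotate_vec ^^ k) v))) = 0"
  proof (rule poly_eqI)
    fix i
    show "coeff (\<Sum>k<n. smult (b k) (vec_poly ((rotate_vec ^^ k) v))) i = coeff 0 i"
      using b[of i] carrier_vecD[OF funpow_rotate_vec_carrier[OF v]]
      by (cases "i < n") (simp_all add: coeff_sum coeff_vec_poly)
  qed
  ultimately have dvd: "?N dvd B * vec_poly v" by (simp add: cong_0_iff)
  then have "?G dvd B * vec_poly v"
    by (metis dvd_mult_right monom_minus_1_eq_geom_poly)
  then have "?G dvd B"
    using geom_poly_not_dvd_vec_poly[OF v supp v0]
      prime_elem_dvd_multD[OF field_poly_irreducible_imp_prime[OF irr]] by blast
  then obtain g where g: "B = ?G * g" by (elim dvdE)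
  \<comment> \<open>The factor X - 1 is handled by evaluation at 1, where \<open>vec_poly v\<close>
    takes the entry sum as its value.\<close>
  have "[:-1, 1:] dvd B * vec_poly v"
    using dvd unfolding monom_minus_1_eq_geom_poly[of n] monom_1_minus_1 by (rule dvd_mult_left)
  then have "poly (B * vec_poly v) 1 = 0" by (simp only: poly_eq_0_iff_dvd)
  moreover have "poly (vec_poly v) 1 = (\<Sum>i<n. v $ i)"
    using v by (simp add: vec_poly_def poly_sum poly_monom)
  ultimately have B1: "poly B 1 = 0" using v0 by simp
  have cB: "coeff B i = (if i < n then b i else 0)" for i
    by (simp add: B_def coeff_sum sum.delta')
  have "B = 0"
  proof (rule ccontr)
    assume "B \<noteq> 0"
    then have "g \<noteq> 0" using g by auto
    have "degree B \<le> n - 1" using n by (intro degree_le) (auto simp: cB)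
    then have "degree g = 0"
      using g \<open>g \<noteq> 0\<close> geom_poly_neq_0[OF n, where 'a = 'a]
      by (simp add: degree_mult_eq degree_geom_poly)
    then obtain c where c: "g = [:c:]" by (meson degree_eq_zeroE)
    then have "of_nat n * c = 0" using B1 g by (auto simp: poly_geom_poly_1)
    then show False using n0 c \<open>g \<noteq> 0\<close> by auto
  qed
  then show ?thesis using cB[of k] k by simp
qed


section \<open>Vectors of weight s with nonzero sum: invariance under rotation and their
  number\<close>

lemma finite_carrier_vec: "finite (carrier_vec n :: 'a :: finite vec set)"
proof (rule finite_subset)
  show "carrier_vec n \<subseteq> vec_of_list ` {xs :: 'a list. set xs \<subseteq> UNIV \<and> length xs = n}"
  proof
    fix v :: "'a vec" assume "v \<in> carrier_vec n"
    then show "v \<in> vec_of_list ` {xs. set xs \<subseteq> UNIV \<and> length xs = n}"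
      by (intro image_eqI[of _ _ "list_of_vec v"]) (auto simp: vec_list)
  qed
qed (intro finite_imageI finite_lists_length_eq, simp)

lemma finite_carrier_mat: "finite (carrier_mat n m :: 'a :: finite mat set)"
proof (rule finite_subset)
  show "carrier_mat n m \<subseteq> mat_of_cols n ` {vs. set vs \<subseteq> (carrier_vec n :: 'a vec set) \<and> length vs = m}"
  proof
    fix A :: "'a mat" assume A: "A \<in> carrier_mat n m"
    then show "A \<in> mat_of_cols n ` {vs. set vs \<subseteq> carrier_vec n \<and> length vs = m}"
      using cols_dim[of A] by (intro image_eqI[of _ _ "cols A"]) auto
  qed
qed (intro finite_imageI finite_lists_length_eq finite_carrier_vec)

text \<open>The condition on the sum keeps X - 1 from dividing \<open>vec_poly v\<close>; for s < n
  the weight keeps \<open>geom_poly n\<close> from dividing it.\<close>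

definition weight_vecs :: "nat \<Rightarrow> nat \<Rightarrow> 'a :: field vec set" where
  "weight_vecs n s =
     {v \<in> carrier_vec n. card {i. i < n \<and> v $ i \<noteq> 0} = s \<and> (\<Sum>i<n. v $ i) \<noteq> 0}"

lemma weight_vecs_carrier: "weight_vecs n s \<subseteq> carrier_vec n"
  by (auto simp: weight_vecs_def)

lemma bij_betw_cyclic_pred:
  "bij_betw (\<lambda>i. if i = 0 then n - 1 else i - 1) {..<n} {..<n :: nat}"
  by (rule bij_betw_byWitness[where f' = "\<lambda>i. if i = n - 1 then 0 else Suc i"]) auto

lemma rotate_vec_weight_vecs:
  fixes v :: "'a :: field vec"
  assumes "v \<in> weight_vecs n s"
  shows "rotate_vec v \<in> weight_vecs n s"
proof -
  let ?\<pi> = "\<lambda>i. if i = 0 then n - 1 else i - 1"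
  have v: "v \<in> carrier_vec n" using assms by (simp add: weight_vecs_def)
  have rot: "rotate_vec v $ i = v $ ?\<pi> i" if "i < n" for i
    using that v by (simp add: rotate_vec_def)
  \<comment> \<open>Weight and entry sum both become sums over the entries, so one cyclic reindexing
    preserves both.\<close>
  have supp: "card {i. i < n \<and> w $ i \<noteq> 0} = (\<Sum>i<n. of_bool (w $ i \<noteq> 0))" for w :: "'a vec"
  proof -
    have "{..<n} \<inter> {i. w $ i \<noteq> 0} = {i. i < n \<and> w $ i \<noteq> 0}" by auto
    then show ?thesis by simp
  qed
  have sums: "(\<Sum>i<n. h (rotate_vec v $ i)) = (\<Sum>i<n. h (v $ i))" for h :: "'a \<Rightarrow> 'b :: comm_monoid_add"
    unfolding sum.reindex_bij_betw[OF bij_betw_cyclic_pred, of "\<lambda>i. h (v $ i)" n, symmetric]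
    by (intro sum.cong refl) (simp only: rot lessThan_iff)
  show ?thesis
    using assms v sums[of "\<lambda>x. x"] sums[of "\<lambda>x. of_bool (x \<noteq> 0) :: nat"]
    unfolding weight_vecs_def mem_Collect_eq supp by simp
qed

lemma inj_on_rotate_vec: "inj_on rotate_vec (carrier_vec n)"
proof (rule inj_onI)
  fix v w :: "'a vec"
  assume vw: "v \<in> carrier_vec n" "w \<in> carrier_vec n" and eq: "rotate_vec v = rotate_vec w"
  show "v = w"
  proof (rule eq_vecI)
    fix i assume "i < dim_vec w"
    then have "i \<in> {..<n}" using vw by simp
    then obtain j where "j < n" "i = (if j = 0 then n - 1 else j - 1)"
      using bij_betw_imp_surj_on[OF bij_betw_cyclic_pred, of n] by blast
    then show "v $ i = w $ i"
      using arg_cong[OF eq, of "\<lambda>u. u $ j"] vw by (auto simp: rotate_vec_def split: if_splits)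
  qed (use vw in simp)
qed

lemma bij_betw_funpow_rotate_vec:
  assumes "finite (weight_vecs n s :: 'a :: field vec set)"
  shows "bij_betw (rotate_vec ^^ k) (weight_vecs n s) (weight_vecs n s :: 'a vec set)"
proof -
  have "bij_betw rotate_vec (weight_vecs n s) (weight_vecs n s :: 'a vec set)"
    unfolding bij_betw_def
    by (meson assms endo_inj_surj image_subsetI inj_on_rotate_vec inj_on_subset
        rotate_vec_weight_vecs weight_vecs_carrier)
  then show ?thesis
    by (induction k) (auto simp: bij_betw_id intro: bij_betw_trans)
qed

text \<open>In a zero-sum function the value at one chosen point a is determined by the others, so
  restriction to \<open>S - {a}\<close> is injective on the zero-sum functions. This bounds the
  number to be subtracted from that of all nowhere-zero functions.\<close>

lemma card_nonzero_functions_nonzero_sum: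
  assumes S: "finite S" "S \<noteq> {}"
  shows "(CARD('a :: {field, finite}) - 1) ^ card S - (CARD('a) - 1) ^ (card S - 1)
    \<le> card {f \<in> S \<rightarrow>\<^sub>E UNIV - {0 :: 'a}. sum f S \<noteq> 0}"
proof -
  let ?F = "S \<rightarrow>\<^sub>E UNIV - {0 :: 'a}"
  let ?Z = "{f \<in> ?F. sum f S = 0}"
  obtain a where a: "a \<in> S" using S by auto
  have fin: "finite ?F" using S by (intro finite_PiE) auto
  have "card ?Z \<le> card (S - {a} \<rightarrow>\<^sub>E UNIV - {0 :: 'a})"
  proof (rule card_inj_on_le)
    show "inj_on (\<lambda>f. restrict f (S - {a})) ?Z"
    proof (rule inj_onI)
      fix f g assume f: "f \<in> ?Z" and g: "g \<in> ?Z"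
        and eq: "restrict f (S - {a}) = restrict g (S - {a})"
      have fg: "f x = g x" if "x \<in> S - {a}" for x
        using fun_cong[OF eq, of x] that by (simp only: restrict_apply if_True)
      then have "sum f (S - {a}) = sum g (S - {a})" by (rule sum.cong[OF refl])
      moreover have "f a + sum f (S - {a}) = 0" "g a + sum g (S - {a}) = 0"
        using f g sum.remove[OF S(1) a, of f] sum.remove[OF S(1) a, of g] by auto
      ultimately have "f a = g a" by (metis add_right_cancel)
      then have "f x = g x" if "x \<in> S" for x
        using fg[of x] that by (cases "x = a") auto
      then show "f = g" using f g by (intro PiE_ext) auto
    qed
    show "(\<lambda>f. restrict f (S - {a})) ` ?Z \<subseteq> (S - {a} \<rightarrow>\<^sub>E UNIV - {0})"
      by (auto simp: PiE_iff split: if_splits)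
  qed (use S in \<open>intro finite_PiE, auto\<close>)
  also have "\<dots> = (CARD('a) - 1) ^ (card S - 1)"
    using S a by (simp add: card_PiE card_Diff_subset)
  finally have Z: "card ?Z \<le> (CARD('a) - 1) ^ (card S - 1)" .
  have "{f \<in> ?F. sum f S \<noteq> 0} = ?F - ?Z" by auto
  then have "card {f \<in> ?F. sum f S \<noteq> 0} = card ?F - card ?Z"
    using fin by (simp add: card_Diff_subset)
  moreover have "card ?F = (CARD('a) - 1) ^ card S"
    using S by (simp add: card_PiE card_Diff_subset)
  ultimately show ?thesis using Z by (simp add: diff_le_mono2)
qed

text \<open>A support S of size s together with nonzero values f on S of nonzero sum gives a vector
  through extension by 0; S is recovered as its support and f as its entries there.\<close>

lemma card_weight_vecs_ge:
  assumes "s \<ge> 1"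
  shows "(n choose s) * ((CARD('a :: {field, finite}) - 1) ^ s - (CARD('a) - 1) ^ (s - 1))
    \<le> card (weight_vecs n s :: 'a vec set)"
proof -
  let ?I = "{S. S \<subseteq> {..<n} \<and> card S = s}"
  let ?F = "\<lambda>S. {f \<in> S \<rightarrow>\<^sub>E UNIV - {0 :: 'a}. sum f S \<noteq> 0}"
  let ?h = "\<lambda>(S, f). vec n (\<lambda>i. if i \<in> S then f i else 0)"
  have finI: "finite ?I" by simp
  have S: "finite S" "S \<noteq> {}" if "S \<in> ?I" for S
    using that assms by (auto intro: finite_subset)
  have finF: "finite (?F S)" if "S \<in> ?I" for S
    using S[OF that] by (intro finite_Collect_conjI disjI1) (auto intro: finite_PiE)
  have supp: "{i. i < n \<and> ?h (S, f) $ i \<noteq> 0} = S" if "S \<in> ?I" "f \<in> ?F S" for S f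
    using that by (auto simp: PiE_iff split: if_splits)
  have "(n choose s) * ((CARD('a) - 1) ^ s - (CARD('a) - 1) ^ (s - 1))
      = (\<Sum>S\<in>?I. (CARD('a) - 1) ^ s - (CARD('a) - 1) ^ (s - 1))"
    by (simp add: n_subsets)
  also have "\<dots> \<le> (\<Sum>S\<in>?I. card (?F S))"
  proof (rule sum_mono)
    fix S assume "S \<in> ?I"
    then show "(CARD('a) - 1) ^ s - (CARD('a) - 1) ^ (s - 1) \<le> card (?F S)"
      using card_nonzero_functions_nonzero_sum[OF S, of S, where 'a = 'a] by simp
  qed
  also have "\<dots> = card (Sigma ?I ?F)"
    using finI finF by (simp add: card_SigmaI)
  also have "\<dots> \<le> card (weight_vecs n s :: 'a vec set)"
  proof (rule card_inj_on_le)
    show "inj_on ?h (Sigma ?I ?F)"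
    proof (rule inj_onI)
      fix x y assume x: "x \<in> Sigma ?I ?F" and y: "y \<in> Sigma ?I ?F" and eq: "?h x = ?h y"
      obtain S f T g where xy: "x = (S, f)" "y = (T, g)" by (cases x, cases y)
      have "S = T" using supp[of S f] supp[of T g] x y eq unfolding xy by auto
      moreover have "f i = g i" if "i \<in> S" for i
        using arg_cong[OF eq, of "\<lambda>v. v $ i"] that x \<open>S = T\<close> unfolding xy by auto
      ultimately show "x = y"
        using x y unfolding xy by (auto intro: PiE_ext)
    qed
    show "?h ` Sigma ?I ?F \<subseteq> weight_vecs n s"
    proof (rule image_subsetI)
      fix x assume x: "x \<in> Sigma ?I ?F"
      obtain S f where xS: "x = (S, f)" by (cases x)
      have "(\<Sum>i<n. ?h (S, f) $ i) = sum f S"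
        using x unfolding xS by (auto simp: sum.If_cases Int_absorb1 intro!: sum.cong)
      then show "?h x \<in> weight_vecs n s"
        using x supp[of S f] unfolding xS weight_vecs_def by auto
    qed
    show "finite (weight_vecs n s :: 'a vec set)"
      using finite_subset[OF weight_vecs_carrier finite_carrier_vec] .
  qed
  finally show ?thesis .
qed

section \<open>Counting independent lists of such vectors\<close>

context vec_space
begin

lemma lin_indpt_rotations:
  assumes irr: "irreducible (geom_poly n :: 'a poly)" and n0: "(of_nat n :: 'a) \<noteq> 0"
    and v: "v \<in> weight_vecs n s" and s: "s < n"
  shows "inj_on (\<lambda>k. (rotate_vec ^^ k) v) {..<n}"
    and "lin_indpt ((\<lambda>k. (rotate_vec ^^ k) v) ` {..<n})"
proof -
  let ?r = "\<lambda>k. (rotate_vec ^^ k) v"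
  have vW: "v \<in> carrier_vec n" "card {i. i < n \<and> v $ i \<noteq> 0} \<noteq> n" "(\<Sum>i<n. v $ i) \<noteq> 0"
    using v s by (auto simp: weight_vecs_def)
  note indep = rotations_independent[OF irr n0 vW]
  show inj: "inj_on ?r {..<n}"
  proof (rule inj_onI, rule ccontr)
    fix k l assume kl: "k \<in> {..<n}" "l \<in> {..<n}" "?r k = ?r l" "k \<noteq> l"
    \<comment> \<open>Two equal rotations would give a linear relation with coefficients 1 at k and
      -1 at l.\<close>
    let ?b = "\<lambda>j. of_bool (j = k) - of_bool (j = l) :: 'a"
    have "?b k = 0"
    proof (rule indep[of ?b])
      fix i assume "i < n"
      show "(\<Sum>j<n. ?b j * ?r j $ i) = 0"
        using kl by (simp add: left_diff_distrib sum_subtractf of_bool_def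
            if_distrib[of "\<lambda>x. x * _"] cong: if_cong)
    qed (use kl in simp)
    then show False using kl by simp
  qed
  show "lin_indpt (?r ` {..<n})"
  proof (rule finite_lin_indpt2)
    show sub: "?r ` {..<n} \<subseteq> carrier_vec n" using vW(1) by auto
    fix a assume a: "lincomb a (?r ` {..<n}) = 0\<^sub>v n"
    have "a (?r k) = 0" if "k < n" for k
    proof (rule indep[of "\<lambda>k. a (?r k)"])
      fix i assume i: "i < n"
      show "(\<Sum>k<n. a (?r k) * ?r k $ i) = 0"
        using arg_cong[OF a, of "\<lambda>u. u $ i"] lincomb_index[OF i sub, of a] i
        by (simp add: sum.reindex[OF inj])
    qed (rule that)
    then show "\<forall>w\<in>?r ` {..<n}. a w = 0" by auto
  qed simp
qed

text \<open>Count pairs (k, v) whose k-th rotation of v lies in the span. Each rotation permutes the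
  weight vectors, so every k contributes the same number; each v contributes at most
  \<open>card S\<close>, its rotations being independent.\<close>

lemma card_weight_vecs_span:
  assumes irr: "irreducible (geom_poly n :: 'a poly)" and n0: "(of_nat n :: 'a) \<noteq> 0"
    and s: "s < n" and fin: "finite (weight_vecs n s :: 'a vec set)"
    and S: "finite S" "S \<subseteq> carrier_vec n"
  shows "n * card (weight_vecs n s \<inter> span S) \<le> card S * card (weight_vecs n s :: 'a vec set)"
proof -
  let ?W = "weight_vecs n s :: 'a vec set"
  have "n * card (?W \<inter> span S) = (\<Sum>k<n. card (?W \<inter> span S))" by simp
  also have "\<dots> = (\<Sum>k<n. \<Sum>v\<in>?W. of_bool ((rotate_vec ^^ k) v \<in> span S))"
  proof (rule sum.cong[OF refl])
    fix k
    have "card (?W \<inter> span S) = (\<Sum>v\<in>?W. of_bool (v \<in> span S))"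
      using fin by simp
    also have "\<dots> = (\<Sum>v\<in>?W. of_bool ((rotate_vec ^^ k) v \<in> span S))"
      using sum.reindex_bij_betw[OF bij_betw_funpow_rotate_vec[OF fin, of k],
          of "\<lambda>v. of_bool (v \<in> span S) :: nat"]
      by simp
    finally show "card (?W \<inter> span S) = (\<Sum>v\<in>?W. of_bool ((rotate_vec ^^ k) v \<in> span S))" .
  qed
  also have "\<dots> = (\<Sum>v\<in>?W. \<Sum>k<n. of_bool ((rotate_vec ^^ k) v \<in> span S))"
    by (rule sum.swap)
  also have "\<dots> \<le> (\<Sum>v\<in>?W. card S)"
  proof (rule sum_mono)
    fix v assume v: "v \<in> ?W"
    let ?r = "\<lambda>k. (rotate_vec ^^ k) v"
    let ?K = "{..<n} \<inter> {k. ?r k \<in> span S}"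
    note rot = lin_indpt_rotations[OF irr n0 v s]
    have "lin_indpt (?r ` ?K)"
      by (rule subset_li_is_li[OF rot(2)]) auto
    moreover have "?r ` ?K \<subseteq> span S" by auto
    \<comment> \<open>Steinitz exchange: since \<open>card C\<close> is nonnegative, at most
      \<open>card S\<close> rotations lie in the span.\<close>
    ultimately obtain C :: "'a vec set"
      where "int (card C) \<le> int (card S) - int (card (?r ` ?K))"
      using replacement[of "?r ` ?K" S] S by auto
    moreover have "card (?r ` ?K) = card ?K"
      by (rule card_image[OF inj_on_subset[OF rot(1)]]) auto
    ultimately show "(\<Sum>k<n. of_bool (?r k \<in> span S)) \<le> card S" by simp
  qed
  finally show ?thesis by (simp add: mult.commute)
qed

text \<open>Lists record the order of matrix columns; \<open>distinct\<close> excludes repetitions,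
  which \<open>lin_indpt\<close> of the underlying set does not see.\<close>

definition indpt_lists :: "'a vec set \<Rightarrow> nat \<Rightarrow> 'a vec list set" where
  "indpt_lists W r = {vs. length vs = r \<and> distinct vs \<and> set vs \<subseteq> W \<and> lin_indpt (set vs)}"

text \<open>The span of an independent list of length r contains at most the fraction r/n of the
  weight vectors. Any of the remaining ones can be put in front of the list, and the longer list
  determines both head and tail.\<close>

lemma card_indpt_lists_ge:
  assumes irr: "irreducible (geom_poly n :: 'a poly)" and n0: "(of_nat n :: 'a) \<noteq> 0"
    and s: "s < n" and fin: "finite (weight_vecs n s :: 'a vec set)" and r: "r \<le> n"
  shows "(\<Prod>i<r. real (card (weight_vecs n s :: 'a vec set)) * (real n - real i) / real n)
    \<le> real (card (indpt_lists (weight_vecs n s) r))"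
  using r
proof (induction r)
  case 0
  have "lin_indpt {}" by (rule finite_lin_indpt2) auto
  then have "indpt_lists (weight_vecs n s) 0 = {[]}" by (auto simp: indpt_lists_def)
  then show ?case by simp
next
  case (Suc r)
  let ?W = "weight_vecs n s :: 'a vec set"
  let ?L = "indpt_lists ?W"
  let ?c = "real (card ?W) * (real n - real r) / real n"
  have finL: "finite (?L k)" for k
    by (rule finite_subset[OF _ finite_lists_length_eq[OF fin, of k]]) (auto simp: indpt_lists_def)
  have c: "?c \<le> real (card (?W - span (set vs)))" if "vs \<in> ?L r" for vs
  proof -
    have vs: "set vs \<subseteq> carrier_vec n" "card (set vs) = r"
      using that weight_vecs_carrier by (auto simp: indpt_lists_def distinct_card)
    have "real n * real (card (?W \<inter> span (set vs))) \<le> real r * real (card ?W)"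
      using card_weight_vecs_span[OF irr n0 s fin finite_set vs(1)] unfolding vs(2)
      by (metis of_nat_le_iff of_nat_mult)
    moreover have diff: "real (card (?W - span (set vs))) =
        real (card ?W) - real (card (?W \<inter> span (set vs)))"
      using fin by (simp add: card_Diff_subset_Int card_mono of_nat_diff)
    ultimately show ?thesis
      unfolding diff using s by (subst pos_divide_le_eq) (auto simp: algebra_simps)
  qed
  have "(\<Prod>i<Suc r. real (card ?W) * (real n - real i) / real n) =
      (\<Prod>i<r. real (card ?W) * (real n - real i) / real n) * ?c"
    by simp
  also have "\<dots> \<le> real (card (?L r)) * ?c"
    \<comment> \<open>The factor \<open>?c\<close> is nonnegative because r stays below n.\<close>
    using Suc by (intro mult_right_mono) auto
  also have "\<dots> = (\<Sum>vs\<in>?L r. ?c)" by simp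
  also have "\<dots> \<le> (\<Sum>vs\<in>?L r. real (card (?W - span (set vs))))"
    by (rule sum_mono) (rule c)
  also have "\<dots> = real (card (SIGMA vs : ?L r. ?W - span (set vs)))"
    using fin finL by (subst card_SigmaI) auto
  also have "\<dots> \<le> real (card (?L (Suc r)))"
  proof -
    have "(\<lambda>(vs, v). v # vs) ` (SIGMA vs : ?L r. ?W - span (set vs)) \<subseteq> ?L (Suc r)"
    proof (rule image_subsetI)
      fix x assume x: "x \<in> (SIGMA vs : ?L r. ?W - span (set vs))"
      obtain vs v where xv: "x = (vs, v)" by (cases x)
      have vs: "vs \<in> ?L r" and v: "v \<in> ?W" "v \<notin> span (set vs)" using x xv by auto
      have sub: "set vs \<subseteq> carrier_vec n" and li: "lin_indpt (set vs)"
        using vs weight_vecs_carrier by (auto simp: indpt_lists_def)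
      have "v \<notin> set vs" using in_own_span[OF sub] v by blast
      moreover have "lin_indpt (set vs \<union> {v})"
        using lin_dep_iff_in_span[OF sub li _ \<open>v \<notin> set vs\<close>] v weight_vecs_carrier by auto
      ultimately show "(case x of (vs, v) \<Rightarrow> v # vs) \<in> ?L (Suc r)"
        using vs v xv by (auto simp: indpt_lists_def)
    qed
    then have "card (SIGMA vs : ?L r. ?W - span (set vs)) \<le> card (?L (Suc r))"
      using finL by (intro card_inj_on_le[of "\<lambda>(vs, v). v # vs"]) (auto intro: inj_onI)
    then show ?thesis by simp
  qed
  finally show ?case .
qed

lemma mat_of_cols_indpt_lists:
  assumes "r \<le> n"
  shows "mat_of_cols n ` indpt_lists (weight_vecs n s) r \<subseteq> GL_fixed_col_weight s n r"
proof (rule image_subsetI)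
  fix vs :: "'a vec list" assume vs: "vs \<in> indpt_lists (weight_vecs n s) r"
  then have sub: "set vs \<subseteq> carrier_vec n"
    using weight_vecs_carrier by (auto simp: indpt_lists_def)
  have A: "mat_of_cols n vs \<in> carrier_mat n r"
    using vs by (auto simp: indpt_lists_def)
  have "rank (mat_of_cols n vs) = r"
    using lin_indpt_full_rank[OF A] vs cols_mat_of_cols[OF sub] by (simp add: indpt_lists_def)
  moreover have "card {i. i < n \<and> mat_of_cols n vs $$ (i, j) \<noteq> 0} = s" if "j < r" for j
  proof -
    have "vs ! j \<in> weight_vecs n s" "j < length vs"
      using vs that by (auto simp: indpt_lists_def)
    then show ?thesis
      by (auto simp: weight_vecs_def mat_of_cols_index cong: conj_cong)
  qed
  ultimately show "mat_of_cols n vs \<in> GL_fixed_col_weight s n r"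
    using A assms by (simp add: GL_fixed_col_weight_def)
qed

end

section \<open>The bound for matrices\<close>

theorem theorem4:
  fixes q p s r :: nat
  assumes "prime q"
    and "prime p"
    and "CARD('a :: prime_card) = p"
    and "\<exists>g. residue_primroot q g \<and> [p = g] (mod q)"
    and "1 \<le> s" and "s \<le> q - 1"
    and "r \<ge> 1"
  shows "real (card (GL_fixed_col_weight s q r :: 'a mod_ring mat set))
       \<ge> (\<Prod>i\<in>{0..r - 1}.
            1 / real q * real (q choose s)
              * ((real p - 1) ^ s - (real p - 1) ^ (s - 1)) * (real q - real i))"
proof (cases "r \<le> q")
  case False
  \<comment> \<open>For r > q the factor with i = q is 0, so the bound is trivial.\<close>
  then have "q \<in> {0..r - 1}" by auto
  then have "(\<Prod>i\<in>{0..r - 1}. 1 / real q * real (q choose s)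
      * ((real p - 1) ^ s - (real p - 1) ^ (s - 1)) * (real q - real i)) = 0"
    by (intro prod_zero) auto
  then show ?thesis by (simp only: of_nat_0_le_iff)
next
  case True
  interpret vec_space "TYPE('a mod_ring)" q .
  let ?W = "weight_vecs q s :: 'a mod_ring vec set"
  have q: "q > 1" "s < q" using assms prime_gt_1_nat by auto
  have prim: "residue_primroot q CARD('a)"
    using assms by (metis residue_primroot_cong)
  have irr: "irreducible (geom_poly q :: 'a mod_ring poly)"
    using assms(1) prim by (rule irreducible_geom_poly)
  have q0: "(of_nat q :: 'a mod_ring) \<noteq> 0"
    using prim by (intro of_nat_mod_ring_neq_0) (simp add: residue_primroot_def)
  have fin: "finite ?W"
    using finite_subset[OF weight_vecs_carrier finite_carrier_vec] .
  have p: "p \<ge> 2" using assms prime_ge_2_nat by blast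
  have "real (q choose s) * ((real p - 1) ^ s - (real p - 1) ^ (s - 1))
      = real ((q choose s) * ((p - 1) ^ s - (p - 1) ^ (s - 1)))"
    \<comment> \<open>As p is at least 2, the subtractions of natural numbers are not truncated and
      agree with the real ones.\<close>
    using p by (simp add: of_nat_diff power_increasing)
  also have "\<dots> \<le> real (card ?W)"
    using card_weight_vecs_ge[of s q, where 'a = "'a mod_ring"] assms
    by (subst of_nat_le_iff) simp
  finally have W:
    "real (q choose s) * ((real p - 1) ^ s - (real p - 1) ^ (s - 1)) \<le> real (card ?W)" .
  have nonneg: "(real p - 1) ^ s - (real p - 1) ^ (s - 1) \<ge> 0"
    using p by (simp add: power_increasing)
  have "(\<Prod>i\<in>{0..r - 1}. 1 / real q * real (q choose s)
      * ((real p - 1) ^ s - (real p - 1) ^ (s - 1)) * (real q - real i))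
    \<le> (\<Prod>i<r. real (card ?W) * (real q - real i) / real q)"
  proof -
    \<comment> \<open>This needs r \<ge> 1: for r = 0 the left side would be
      \<open>{0}\<close>.\<close>
    have "{0..r - 1} = {..<r}" using assms(7) by auto
    moreover have "(\<Prod>i<r. 1 / real q * real (q choose s)
        * ((real p - 1) ^ s - (real p - 1) ^ (s - 1)) * (real q - real i))
      \<le> (\<Prod>i<r. real (card ?W) * (real q - real i) / real q)"
    proof (rule prod_mono, rule conjI)
      fix i assume "i \<in> {..<r}"
      then have i: "real q - real i \<ge> 0" using True by simp
      show "0 \<le> 1 / real q * real (q choose s)
          * ((real p - 1) ^ s - (real p - 1) ^ (s - 1)) * (real q - real i)"
        using i nonneg by simp
      have "real (q choose s) * ((real p - 1) ^ s - (real p - 1) ^ (s - 1)) * ((real q - real i) / real q)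
          \<le> real (card ?W) * ((real q - real i) / real q)"
        using W i by (intro mult_right_mono) auto
      then show "1 / real q * real (q choose s)
          * ((real p - 1) ^ s - (real p - 1) ^ (s - 1)) * (real q - real i)
        \<le> real (card ?W) * (real q - real i) / real q"
        by (simp add: mult_ac)
    qed
    ultimately show ?thesis by simp
  qed
  also have "\<dots> \<le> real (card (indpt_lists ?W r))"
    by (rule card_indpt_lists_ge[OF irr q0 q(2) fin True])
  also have "\<dots> \<le> real (card (GL_fixed_col_weight s q r :: 'a mod_ring mat set))"
  proof -
    \<comment> \<open>Taking columns recovers the list, so different lists give different
      matrices.\<close>
    have "inj_on (mat_of_cols q) (indpt_lists ?W r)"
    proof (rule inj_on_inverseI)
      fix vs assume "vs \<in> indpt_lists ?W r"
      then show "cols (mat_of_cols q vs) = vs"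
        using weight_vecs_carrier by (intro cols_mat_of_cols) (auto simp: indpt_lists_def)
    qed
    moreover have "finite (GL_fixed_col_weight s q r :: 'a mod_ring mat set)"
      by (rule finite_subset[OF _ finite_carrier_mat[of q r]]) (auto simp: GL_fixed_col_weight_def)
    ultimately show ?thesis
      using mat_of_cols_indpt_lists[OF True] by (simp add: card_inj_on_le)
  qed
  finally show ?thesis .
qed

end
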